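(* Fix an integer $r\ge 0$. There is an absolute constant $0<c<1$ (depending on nothing but the fixed $r$) such that the following holds. Let $\{\zeta_n\}$ be any diverging sequence and let $\kappa>0$, $\sigma>0$ be parameters (allowed to depend on $n$). Let $P_{\kappa,\Delta,\sigma,r,n}$ denote the joint distribution of data $(y_1,\dots,y_n)$ from the piecewise polynomial model of the context with exactly one change point, with $r_1=r$, jump size $\kappa_{1,r}=\kappa$, minimal spacing $\Delta$ and noise level $\sigma$, and consider the class \[ \mathcal{Q}=\{P_{\kappa,\Delta,\sigma,r,n}:\ \Delta<n/2,\ \ \kappa^2\Delta^{2r+1}\ge\sigma^2n^{2r}\zeta_n\}. \] Then for all $n$ large enough, \[ \inf_{\widehat\eta}\ \sup_{P\in\mathcal{Q}}\ \mathbb{E}_P\big(|\widehat\eta-\eta(P)|\big)\ \ge\ \Big[\frac{c\,n^{2r}\sigma^2}{\kappa^2}\Big]^{1/(2r+1)}, \] where $\eta(P)$ is the location of the change point for the distribution $P$ and the infimum is over all estimators $\widehat\eta$, i.e. all measurable functions of the data.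
   Context: **Model with one change point.** $y_i=f(i/n)+\varepsilon_i$, $i=1,\dots,n$. There is an integer $\eta_1$ (the change point) with $1=\eta_0<\eta_1\le n<\eta_2=n+1$ such that $f:[0,1]\to\mathbb{R}$ restricted to each of $[\eta_0/n,\eta_1/n)$ and $[\eta_1/n,\eta_2/n)$ is a polynomial of degree at most $r$. The $\varepsilon_i$ are independent, mean zero, sub-Gaussian with $\max_i\|\varepsilon_i\|_{\psi_2}\le\sigma$, where $\|X\|_{\psi_2}=\inf\{t>0:\mathbb{E}\exp(X^2/t^2)\le2\}$. Write $f(x)=\sum_{l=0}^r a_{1,l}(x-\eta_1/n)^l$ on $[\eta_0/n,\eta_1/n)$ and $f(x)=\sum_{l=0}^r b_{1,l}(x-\eta_1/n)^l$ on $[\eta_1/n,\eta_2/n)$. The minimal spacing is $\Delta=\Delta_1=\min\{\eta_1-\eta_0,\eta_2-\eta_1\}>0$. For $l=0,\dots,r$ let $\kappa_{1,l}=|a_{1,l}-b_{1,l}|$ and $\rho_{1,l}=\kappa_{1,l}^2\Delta_1^{2l+1}n^{-2l}$; it is assumed that $\max_l\rho_{1,l}>0$. **The order $r_1$.** With one change point, let $\lambda=c_{\mathrm{noise}}\sigma^2\log(n)$ and $\mathcal{S}_1=\{l\in\{0,\dots,r\}:\rho_{1,l}\ge c_{\mathrm{signal}}\lambda\}$, where $c_{\mathrm{noise}},c_{\mathrm{signal}}>0$ are fixed constants (depending only on $r$). Then \[ r_1=\min\Big\{\operatorname*{argmin}_{l\in\mathcal{S}_1}\Big(\frac{\sigma^2\log(n)}{\rho_{1,l}}\Big)^{1/(2l+1)}\Big\},\qquad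 \kappa=\kappa_{1,r_1}. \]
   Formalization: The bound is claimed only for large n with κ ≤ n^r σ and with two members of Q whose change points are at least (n^{2r}σ²/κ²)^{1/(2r+1)} apart (otherwise false, e.g. Q empty, or r=0 with κ/σ large); as P may not determine η(P), the sup is over pairs (P, η). *)

theory Defs
  imports "HOL-Probability.Probability"
begin

text \<open>The infimum is taken in \<^typ>\<open>ennreal\<close>, so a random variable that is not
  sub-Gaussian has norm \<^term>\<open>\<infinity> :: ennreal\<close>.\<close>

definition psi2_norm :: "'a measure \<Rightarrow> ('a \<Rightarrow> real) \<Rightarrow> ennreal" where
  "psi2_norm M X =
     Inf {ennreal t | t. t > 0 \<and> (\<integral>\<^sup>+ x. ennreal (exp ((X x)\<^sup>2 / t\<^sup>2)) \<partial>M) \<le> 2}"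

definition data_space :: "nat \<Rightarrow> (nat \<Rightarrow> real) measure" where
  "data_space n = (\<Pi>\<^sub>M i\<in>{1..n}. borel)"

definition spacing :: "nat \<Rightarrow> nat \<Rightarrow> nat" where
  "spacing n \<eta> = min (\<eta> - 1) (n + 1 - \<eta>)"

text \<open>Below, \<open>a\<close> and \<open>b\<close> are the coefficients, in powers of \<open>x - \<eta> / n\<close>, of the polynomial
  pieces to the left and to the right of the change point \<open>\<eta>\<close>.\<close>

definition jump :: "(nat \<Rightarrow> real) \<Rightarrow> (nat \<Rightarrow> real) \<Rightarrow> nat \<Rightarrow> real" where
  "jump a b l = \<bar>a l - b l\<bar>"

definition signal :: "nat \<Rightarrow> nat \<Rightarrow> (nat \<Rightarrow> real) \<Rightarrow> (nat \<Rightarrow> real) \<Rightarrow> nat \<Rightarrow> real" where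
  "signal n \<eta> a b l =
     (jump a b l)\<^sup>2 * real (spacing n \<eta>) ^ (2 * l + 1) / real n ^ (2 * l)"

text \<open>\<open>P\<close> is the law of the data \<open>y\<close>, so under \<open>P\<close> the noise variables are the functions
  \<open>\<lambda>y. y i - f (i / n)\<close>. The pieces are prescribed on the whole intervals up to \<open>(n + 1) / n\<close>,
  which determines \<open>a\<close> and \<open>b\<close> from \<open>f\<close> also when \<open>\<eta> = n\<close>.\<close>

definition one_change_model ::
  "nat \<Rightarrow> nat \<Rightarrow> real \<Rightarrow> (nat \<Rightarrow> real) measure \<Rightarrow> nat \<Rightarrow> (nat \<Rightarrow> real) \<Rightarrow> (nat \<Rightarrow> real) \<Rightarrow> bool" where
  "one_change_model n r \<sigma> P \<eta> a b \<longleftrightarrow>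
     1 < \<eta> \<and> \<eta> \<le> n \<and>
     prob_space P \<and> sets P = sets (data_space n) \<and>
     (\<exists>f :: real \<Rightarrow> real.
        (\<forall>x \<in> {1 / real n ..< real \<eta> / real n}.
           f x = (\<Sum>l = 0..r. a l * (x - real \<eta> / real n) ^ l)) \<and>
        (\<forall>x \<in> {real \<eta> / real n ..< (real n + 1) / real n}.
           f x = (\<Sum>l = 0..r. b l * (x - real \<eta> / real n) ^ l)) \<and>
        prob_space.indep_vars P (\<lambda>_. borel) (\<lambda>i y. y i - f (real i / real n)) {1..n} \<and>
        (\<forall>i \<in> {1..n}.
           integrable P (\<lambda>y. y i - f (real i / real n)) \<and>
           (\<integral>y. y i - f (real i / real n) \<partial>P) = 0 \<and>
           psi2_norm P (\<lambda>y. y i - f (real i / real n)) \<le> ennreal \<sigma>)) \<and>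
     (MAX l \<in> {0..r}. signal n \<eta> a b l) > 0"

text \<open>The constants \<open>cn\<close> and \<open>cs\<close> are those of the noise and of the signal level.\<close>

definition active_orders ::
  "nat \<Rightarrow> nat \<Rightarrow> real \<Rightarrow> real \<Rightarrow> real \<Rightarrow> nat \<Rightarrow> (nat \<Rightarrow> real) \<Rightarrow> (nat \<Rightarrow> real) \<Rightarrow> nat set" where
  "active_orders n r cn cs \<sigma> \<eta> a b =
     {l \<in> {0..r}. signal n \<eta> a b l \<ge> cs * (cn * \<sigma>\<^sup>2 * ln (real n))}"

definition order_rate ::
  "nat \<Rightarrow> real \<Rightarrow> nat \<Rightarrow> (nat \<Rightarrow> real) \<Rightarrow> (nat \<Rightarrow> real) \<Rightarrow> nat \<Rightarrow> real" where
  "order_rate n \<sigma> \<eta> a b l =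
     (\<sigma>\<^sup>2 * ln (real n) / signal n \<eta> a b l) powr (1 / (2 * real l + 1))"

text \<open>Meaningful only if \<^const>\<open>active_orders\<close> is nonempty.\<close>

definition change_order ::
  "nat \<Rightarrow> nat \<Rightarrow> real \<Rightarrow> real \<Rightarrow> real \<Rightarrow> nat \<Rightarrow> (nat \<Rightarrow> real) \<Rightarrow> (nat \<Rightarrow> real) \<Rightarrow> nat" where
  "change_order n r cn cs \<sigma> \<eta> a b =
     Min {l. is_arg_min (order_rate n \<sigma> \<eta> a b) (\<lambda>l. l \<in> active_orders n r cn cs \<sigma> \<eta> a b) l}"

text \<open>The law \<open>P\<close> alone need not determine the change point: a continuous kink located on the
  grid can be assigned to either of two neighbouring grid points. Hence the members of the
  class are pairs of a law and its change point.\<close>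

definition model_class ::
  "nat \<Rightarrow> nat \<Rightarrow> real \<Rightarrow> real \<Rightarrow> real \<Rightarrow> real \<Rightarrow> real \<Rightarrow> ((nat \<Rightarrow> real) measure \<times> nat) set" where
  "model_class n r cn cs \<kappa> \<sigma> z =
     {(P, \<eta>). \<exists>a b.
        one_change_model n r \<sigma> P \<eta> a b \<and>
        active_orders n r cn cs \<sigma> \<eta> a b \<noteq> {} \<and>
        change_order n r cn cs \<sigma> \<eta> a b = r \<and>
        jump a b r = \<kappa> \<and>
        real (spacing n \<eta>) < real n / 2 \<and>
        \<kappa>\<^sup>2 * real (spacing n \<eta>) ^ (2 * r + 1) \<ge> \<sigma>\<^sup>2 * real n ^ (2 * r) * z}"

definition minimax_risk :: "nat \<Rightarrow> ((nat \<Rightarrow> real) measure \<times> nat) set \<Rightarrow> ennreal" where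
  "minimax_risk n Q =
     (INF est \<in> borel_measurable (data_space n).
        SUP (P, \<eta>) \<in> Q. \<integral>\<^sup>+ y. ennreal \<bar>est y - real \<eta>\<bar> \<partial>P)"

end

theory Submission
  imports Defs
begin

text \<open>
  The bound is Le Cam's two-point method. Write \<open>m\<close> for the asserted rate without the
  constant, so that \<open>m ^ (2 r + 1) = n ^ (2 r) \<sigma>\<^sup>2 / \<kappa>\<^sup>2\<close>; the hypothesis \<open>\<kappa> \<le> n ^ r \<sigma>\<close> says
  \<open>m \<ge> 1\<close>. It suffices to find two members of the class whose change points \<open>u < w\<close> are
  at a distance comparable to \<open>m\<close> and whose laws overlap by a constant: no estimator can then
  be close to both change points.

  Take the polynomial \<open>g(x) = \<kappa> (x - u / n) ^ r\<close> and let the regression functions be \<open>- g / 2\<close> to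
  the left and \<open>g / 2\<close> to the right of the change point, which is \<open>u\<close> for the first law and \<open>w\<close> for
  the second. They differ only at the design points \<open>u, \<dots>, w - 1\<close>, where their values are
  \<open>\<plusminus> g / 2\<close>. At all other points the data are taken to be noiseless, which costs nothing since
  the two laws agree there. On the window the data take only the values \<open>\<plusminus> s\<close> with
  \<open>s\<^sup>2 = \<sigma>\<^sup>2 / 2\<close>, with the probabilities that produce the prescribed mean \<open>\<mu>\<close>. The noise \<open>y - \<mu>\<close> then
  has \<open>\<psi>\<^sub>2\<close>-norm at most \<open>\<sigma>\<close> for every mean \<open>\<mu>\<close> in \<open>[- s, s]\<close> (lemma \<open>coin_sub_gaussian\<close>); this
  uniformity allows \<open>\<kappa>\<close> to be as large as \<open>n ^ r \<sigma>\<close>, where the two means are up to \<open>\<sigma>\<close> apart.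

  For two such coins with opposite means the product of the probabilities of a value is
  \<open>1 - (\<mu> / s)\<^sup>2\<close> times the squared probability under the fair coin, whichever value occurs.
  Multiplying over the design points gives \<open>p\<^sub>0 p\<^sub>1 \<ge> K q\<^sup>2\<close> pointwise for the two laws and the
  law \<open>q\<close> of fair coins, with \<open>K \<ge> 1 / 4\<close> (lemma \<open>kinked_overlap\<close>), and this inequality alone
  bounds the sum of the two risks from below by \<open>K / 2\<close> times the distance of the change points
  (lemma \<open>two_point_risk\<close>). No integral over the product space has to be computed.

  The second law must also have jump order \<open>r\<close>. Expanding \<open>g\<close> about \<open>w / n\<close> produces jumps of all
  orders \<open>l \<le> r\<close>, but the order \<open>r\<close> has the smallest rate as soon as
  \<open>(2 ^ r (w - u)) ^ (2 r + 1) < m ^ (2 r + 1) ln n\<close> (lemma \<open>change_order_eq_top\<close>), and this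
  holds for large \<open>n\<close> because of the factor \<open>ln n\<close>. Finally, the locations admitted by the class
  are those of sufficiently large spacing, except the exact centre of the design; so between
  any two of them at distance at least \<open>m\<close> there is room for the pair \<open>u, w\<close> (lemma \<open>feasible_pair\<close>).
\<close>

section \<open>Two-point noise with a prescribed mean\<close>

text \<open>The derivative of the left-hand side is \<open>- x\<^sup>2 sinh x exp (x\<^sup>2 / 2)\<close>, and at \<open>0\<close> its value
  is \<open>1\<close>. With \<open>x = \<mu> / s\<close> it is, up to the constant \<open>exp (1 / 2)\<close>, the sub-Gaussian moment of a
  coin of mean \<open>\<mu>\<close>.\<close>

lemma cosh_minus_sinh_le:
  "(cosh x - x * sinh x) * exp (x\<^sup>2 / 2) \<le> (1::real)"
proof -
  let ?\<phi> = "\<lambda>x::real. (cosh x - x * sinh x) * exp (x\<^sup>2 / 2)"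
  have nonneg: "?\<phi> x \<le> 1" if "x \<ge> 0" for x
  proof -
    have der: "(?\<phi> has_real_derivative - (t\<^sup>2 * sinh t * exp (t\<^sup>2 / 2))) (at t)" for t
      by (auto intro!: derivative_eq_intros simp: algebra_simps power2_eq_square)
    have "?\<phi> x \<le> ?\<phi> 0"
    proof (rule DERIV_nonpos_imp_nonincreasing[OF that])
      fix t :: real assume "0 \<le> t" "t \<le> x"
      then show "\<exists>y. (?\<phi> has_real_derivative y) (at t) \<and> y \<le> 0"
        using der[of t] by (intro exI[of _ "- (t\<^sup>2 * sinh t * exp (t\<^sup>2 / 2))"]) auto
    qed
    then show ?thesis by simp
  qed
  have "?\<phi> x = ?\<phi> \<bar>x\<bar>" by (auto simp: abs_if)
  then show ?thesis using nonneg[of "\<bar>x\<bar>"] by simp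
qed

text \<open>The law on \<open>{- s, s}\<close> with mean \<open>\<mu>\<close>.\<close>

definition coin :: "real \<Rightarrow> real \<Rightarrow> real pmf" where
  "coin s \<mu> = map_pmf (\<lambda>b. if b then s else - s) (bernoulli_pmf ((1 + \<mu> / s) / 2))"

lemma coin_probability:
  fixes s \<mu> :: real
  assumes "0 < s" "\<bar>\<mu>\<bar> \<le> s"
  shows "0 \<le> (1 + \<mu> / s) / 2" "(1 + \<mu> / s) / 2 \<le> 1"
  using assms by (auto simp: field_simps)

lemma nn_integral_coin:
  assumes "0 < s" "\<bar>\<mu>\<bar> \<le> s"
  shows "(\<integral>\<^sup>+ x. ennreal (f x) \<partial>coin s \<mu>)
           = ennreal (f s) * ennreal ((1 + \<mu> / s) / 2) + ennreal (f (- s)) * ennreal ((1 - \<mu> / s) / 2)"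
proof -
  have complement: "1 - (1 + \<mu> / s) / 2 = (1 - \<mu> / s) / 2" by (simp add: field_simps)
  show ?thesis
    unfolding coin_def nn_integral_map_pmf complement[symmetric]
    by (subst nn_integral_bernoulli_pmf) (use coin_probability[OF assms] in simp_all)
qed

lemma expectation_coin:
  assumes "0 < s" "\<bar>\<mu>\<bar> \<le> s"
  shows "measure_pmf.expectation (coin s \<mu>) (\<lambda>x. x) = \<mu>"
  unfolding coin_def integral_map_pmf
  by (subst integral_bernoulli_pmf) (use coin_probability[OF assms] assms in \<open>auto simp: field_simps\<close>)

lemma pmf_coin:
  assumes "0 < s" "\<bar>\<mu>\<bar> \<le> s"
  shows "pmf (coin s \<mu>) x =
    (if x = s then (1 + \<mu> / s) / 2 else if x = - s then (1 - \<mu> / s) / 2 else 0)"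
proof -
  have "(\<lambda>b. if b then s else - s) -` {x} = (if x = s then {True} else if x = - s then {False} else {})"
    using assms by (auto split: if_splits)
  moreover have "1 - (1 + \<mu> / s) / 2 = (1 - \<mu> / s) / 2" by (simp add: field_simps)
  ultimately show ?thesis
    unfolding coin_def pmf_map
    using coin_probability[OF assms] by (simp add: measure_pmf_single)
qed

text \<open>Completing the squares in the two exponents turns the moment into
  \<open>exp (1 / 2) (cosh x - x sinh x) exp (x\<^sup>2 / 2)\<close> with \<open>x = \<mu> / s\<close>, which is at most
  \<open>exp (1 / 2) < 2\<close>. The more biased the coin, the farther its rare value is from the mean, but
  the smaller its probability; hence the same \<open>\<sigma>\<close> serves all means.\<close>

lemma coin_sub_gaussian:
  assumes "0 < s" "\<sigma>\<^sup>2 = 2 * s\<^sup>2" "\<bar>\<mu>\<bar> \<le> s"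
  shows "(\<integral>\<^sup>+ x. ennreal (exp ((x - \<mu>)\<^sup>2 / \<sigma>\<^sup>2)) \<partial>coin s \<mu>) \<le> 2"
proof -
  define x where "x = \<mu> / s"
  have \<mu>: "\<mu> = x * s" using assms by (simp add: x_def)
  have x: "\<bar>x\<bar> \<le> 1" using assms by (simp add: x_def)
  have a: "(s - \<mu>)\<^sup>2 / \<sigma>\<^sup>2 = 1 / 2 + x\<^sup>2 / 2 + - x" "(- s - \<mu>)\<^sup>2 / \<sigma>\<^sup>2 = 1 / 2 + x\<^sup>2 / 2 + x"
    unfolding \<mu> assms(2) using \<open>0 < s\<close> by (auto simp: field_simps power2_eq_square)
  have "exp ((s - \<mu>)\<^sup>2 / \<sigma>\<^sup>2) * ((1 + x) / 2) + exp ((- s - \<mu>)\<^sup>2 / \<sigma>\<^sup>2) * ((1 - x) / 2)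
      = exp (1 / 2) * ((cosh x - x * sinh x) * exp (x\<^sup>2 / 2))"
    unfolding a exp_add by (simp add: cosh_def sinh_def algebra_simps add_divide_distrib diff_divide_distrib)
  also have "\<dots> \<le> exp (1 / 2)" using cosh_minus_sinh_le[of x] by simp
  also have "\<dots> \<le> 2"
    using exp_bound_half[of "1/2::real"] by simp
  finally show ?thesis
    using x unfolding nn_integral_coin[OF \<open>0 < s\<close> \<open>\<bar>\<mu>\<bar> \<le> s\<close>] x_def[symmetric]
    by (simp add: abs_le_iff flip: ennreal_mult ennreal_plus ennreal_numeral)
qed

section \<open>Le Cam's bound from the product of two densities\<close>

text \<open>At each point the weighted errors sum to at least \<open>min p\<^sub>0 p\<^sub>1\<close> times the distance of the
  two parameters. Since \<open>min a b \<ge> a b / (a + b)\<close> and \<open>1 / t \<ge> 1 - t / 4\<close>, applied to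
  \<open>t = (a + b) / u\<close>, the condition \<open>a b \<ge> K u\<^sup>2\<close> yields \<open>min a b \<ge> K (u - (a + b) / 4)\<close>, which
  is linear in the three densities and sums to \<open>K (1 - 2 / 4)\<close>. The best choice of \<open>q\<close> is
  proportional to \<open>sqrt (p\<^sub>0 p\<^sub>1)\<close>; then \<open>K\<close> is the squared Hellinger affinity.\<close>

lemma two_point_risk:
  fixes p0 p1 q :: "'a pmf" and T :: "'a \<Rightarrow> real"
  assumes "0 \<le> K" and overlap: "\<And>y. K * (pmf q y)\<^sup>2 \<le> pmf p0 y * pmf p1 y"
  shows "ennreal (\<bar>\<theta>0 - \<theta>1\<bar> * K / 2)
           \<le> (\<integral>\<^sup>+ y. ennreal \<bar>T y - \<theta>0\<bar> \<partial>p0) + (\<integral>\<^sup>+ y. ennreal \<bar>T y - \<theta>1\<bar> \<partial>p1)"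
    (is "_ \<le> ?R0 + ?R1")
proof -
  define D where "D = \<bar>\<theta>0 - \<theta>1\<bar> * K"
  have D: "D \<ge> 0" using assms by (simp add: D_def)
  have pointwise: "D * u \<le> a * \<bar>t - \<theta>0\<bar> + b * \<bar>t - \<theta>1\<bar> + D / 4 * a + D / 4 * b"
    if "a \<ge> 0" "b \<ge> 0" "u \<ge> 0" "K * u\<^sup>2 \<le> a * b" for a b u t :: real
  proof -
    have "K * u \<le> min a b + K * (a + b) / 4"
    proof (cases "a + b = 0")
      case True
      then have ab: "a = 0" "b = 0" using that by auto
      then have "K * u\<^sup>2 \<le> 0" using that by simp
      then have "K * u = 0" using \<open>0 \<le> K\<close> that by (auto simp: mult_le_0_iff)
      then show ?thesis using ab by auto
    next
      case False
      then have pos: "a + b > 0" using that by simp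
      have "(a + b) * (K * u) \<le> K * u\<^sup>2 + K * (a + b)\<^sup>2 / 4"
      proof -
        have "0 \<le> K * (u - (a + b) / 2)\<^sup>2" using \<open>0 \<le> K\<close> by simp
        then show ?thesis by (simp add: power2_eq_square field_simps)
      qed
      also have "\<dots> \<le> a * b + K * (a + b)\<^sup>2 / 4" using that by simp
      also have "a * b \<le> (a + b) * min a b"
        using that by (auto simp: min_def algebra_simps)
      finally have "(a + b) * (K * u) \<le> (a + b) * (min a b + K * (a + b) / 4)"
        by (simp add: algebra_simps power2_eq_square)
      then show ?thesis using pos by simp
    qed
    then have "\<bar>\<theta>0 - \<theta>1\<bar> * (K * u) \<le> \<bar>\<theta>0 - \<theta>1\<bar> * (min a b + K * (a + b) / 4)"
      by (intro mult_left_mono) auto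
    also have "\<dots> = \<bar>\<theta>0 - \<theta>1\<bar> * min a b + (D / 4 * a + D / 4 * b)"
      by (simp add: D_def algebra_simps)
    also have "\<bar>\<theta>0 - \<theta>1\<bar> * min a b \<le> (\<bar>t - \<theta>0\<bar> + \<bar>t - \<theta>1\<bar>) * min a b"
      using that by (intro mult_right_mono) auto
    also have "\<dots> \<le> a * \<bar>t - \<theta>0\<bar> + b * \<bar>t - \<theta>1\<bar>"
      unfolding distrib_right by (intro add_mono) (auto simp: mult.commute[of _ "min a b"] intro!: mult_right_mono)
    finally show ?thesis by (simp add: D_def algebra_simps)
  qed
  have one: "(\<integral>\<^sup>+ y. ennreal (c * pmf p y) \<partial>count_space UNIV) = ennreal c" if "c \<ge> 0" for c and p :: "'a pmf"
    using that by (simp add: ennreal_mult nn_integral_cmult nn_integral_pmf_eq_1)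
  have "ennreal D = (\<integral>\<^sup>+ y. ennreal (D * pmf q y) \<partial>count_space UNIV)"
    using D by (simp add: one)
  also have "\<dots> \<le> (\<integral>\<^sup>+ y. ennreal (pmf p0 y) * ennreal \<bar>T y - \<theta>0\<bar> + ennreal (pmf p1 y) * ennreal \<bar>T y - \<theta>1\<bar>
                     + ennreal (D / 4 * pmf p0 y) + ennreal (D / 4 * pmf p1 y) \<partial>count_space UNIV)"
    using pointwise[OF pmf_nonneg pmf_nonneg pmf_nonneg overlap] D
    by (intro nn_integral_mono) (simp flip: ennreal_mult ennreal_plus)
  also have "\<dots> = ?R0 + ?R1 + ennreal (D / 4) + ennreal (D / 4)"
    using D by (simp add: nn_integral_add one nn_integral_measure_pmf del: times_divide_eq_left)
  also have "\<dots> = ?R0 + ?R1 + ennreal (D / 2)"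
    using D by (simp add: add.assoc flip: ennreal_plus)
  also have "ennreal D = ennreal (D / 2) + ennreal (D / 2)"
    using D by (simp flip: ennreal_plus)
  \<comment> \<open>Half of \<open>D\<close> is cancelled on both sides; it is finite even when the risks are not.\<close>
  finally have "ennreal (D / 2) + ennreal (D / 2) \<le> ennreal (D / 2) + (?R0 + ?R1)"
    by (simp only: add.commute)
  then show ?thesis
    unfolding ennreal_add_left_cancel_le by (simp add: D_def)
qed

section \<open>Data with independent discrete coordinates\<close>

text \<open>Independence depends on the joint law only, so it may be checked before the space is
  mapped.\<close>

lemma indep_vars_distr:
  assumes "prob_space M" and T: "T \<in> measurable M N" and "I \<noteq> {}"
    and X: "\<And>i. i \<in> I \<Longrightarrow> X i \<in> measurable N (M' i)"
    and ind: "prob_space.indep_vars M M' (\<lambda>i x. X i (T x)) I"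
  shows "prob_space.indep_vars (distr M N T) M' X I"
proof -
  interpret M: prob_space M by fact
  interpret N: prob_space "distr M N T" by (rule M.prob_space_distr[OF T])
  have XT: "(\<lambda>x. X i (T x)) \<in> measurable M (M' i)" if "i \<in> I" for i
    using measurable_compose[OF T X[OF that]] .
  have R: "(\<lambda>x. \<lambda>i\<in>I. X i x) \<in> measurable N (Pi\<^sub>M I M')"
    using X by (intro measurable_restrict)
  have "distr (distr M N T) (Pi\<^sub>M I M') (\<lambda>x. \<lambda>i\<in>I. X i x)
      = distr M (Pi\<^sub>M I M') (\<lambda>x. \<lambda>i\<in>I. X i (T x))"
    by (subst distr_distr[OF R T]) (simp add: comp_def)
  also have "\<dots> = (\<Pi>\<^sub>M i\<in>I. distr M (M' i) (\<lambda>x. X i (T x)))"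
    using M.indep_vars_iff_distr_eq_PiM'[OF \<open>I \<noteq> {}\<close> XT] ind by simp
  also have "\<dots> = (\<Pi>\<^sub>M i\<in>I. distr (distr M N T) (M' i) (X i))"
    by (intro PiM_cong refl) (simp add: distr_distr[OF X T] comp_def)
  finally show ?thesis
    using X by (subst N.indep_vars_iff_distr_eq_PiM'[OF \<open>I \<noteq> {}\<close>]) auto
qed

text \<open>A product of discrete laws keeps its point masses accessible, which the two-point bound
  needs. The restriction changes no value on the support (the default of the product is
  \<open>undefined\<close>); it makes the map take values in the space of extensional functions everywhere.\<close>

definition product_law :: "nat \<Rightarrow> (nat \<Rightarrow> real pmf) \<Rightarrow> (nat \<Rightarrow> real) measure" where
  "product_law n p =
     distr (Pi_pmf {1..n} undefined p) (data_space n) (\<lambda>y. restrict y {1..n})"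

lemma restrict_measurable_pmf:
  "(\<lambda>y. restrict y {1..n}) \<in> measurable (measure_pmf p) (data_space n)"
  by (auto simp: measurable_def data_space_def space_PiM PiE_def)

lemma nn_integral_product_law:
  assumes "f \<in> borel_measurable (data_space n)"
  shows "(\<integral>\<^sup>+ y. f y \<partial>product_law n p)
    = (\<integral>\<^sup>+ y. f (restrict y {1..n}) \<partial>Pi_pmf {1..n} undefined p)"
  unfolding product_law_def
  by (rule nn_integral_distr[OF restrict_measurable_pmf]) (use assms in simp)

lemma prob_space_product_law: "prob_space (product_law n p)"
  unfolding product_law_def
  by (intro measure_pmf.prob_space_distr restrict_measurable_pmf)

lemma sets_product_law: "sets (product_law n p) = sets (data_space n)"
  by (simp add: product_law_def)

lemma measurable_data_component:
  assumes "i \<in> {1..n}"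
  shows "(\<lambda>y. y i) \<in> borel_measurable (data_space n)"
  unfolding data_space_def using assms by measurable

lemma distr_product_law:
  assumes "i \<in> {1..n}"
  shows "distr (product_law n p) borel (\<lambda>y. y i) = distr (p i) borel (\<lambda>x. x)"
proof -
  have "distr (product_law n p) borel (\<lambda>y. y i) = distr (Pi_pmf {1..n} undefined p) borel (\<lambda>y. y i)"
    unfolding product_law_def
    using assms
    by (subst distr_distr[OF measurable_data_component[OF assms] restrict_measurable_pmf]) (simp add: comp_def)
  also have "\<dots> = distr (measure_pmf (map_pmf (\<lambda>y. y i) (Pi_pmf {1..n} undefined p))) borel (\<lambda>x. x)"
    unfolding map_pmf_rep_eq by (subst distr_distr) (auto simp: comp_def)
  also have "\<dots> = distr (p i) borel (\<lambda>x. x)"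
    using assms by (simp add: Pi_pmf_component)
  finally show ?thesis .
qed

lemma nn_integral_product_law_component:
  assumes i: "i \<in> {1..n}" and f: "f \<in> borel_measurable borel"
  shows "(\<integral>\<^sup>+ y. f (y i) \<partial>product_law n p) = (\<integral>\<^sup>+ x. f x \<partial>p i)"
proof -
  have "(\<integral>\<^sup>+ y. f (y i) \<partial>product_law n p) = (\<integral>\<^sup>+ x. f x \<partial>distr (product_law n p) borel (\<lambda>y. y i))"
    using measurable_data_component[OF i] f
    by (subst nn_integral_distr) (auto simp: product_law_def)
  also have "\<dots> = (\<integral>\<^sup>+ x. f x \<partial>p i)"
    unfolding distr_product_law[OF i] by (subst nn_integral_distr) (use f in auto)
  finally show ?thesis .
qed

lemma integrable_product_law_component:
  fixes f :: "real \<Rightarrow> real"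
  assumes i: "i \<in> {1..n}" and f: "f \<in> borel_measurable borel"
  shows "integrable (product_law n p) (\<lambda>y. f (y i)) \<longleftrightarrow> integrable (p i) f"
proof -
  have "integrable (product_law n p) (\<lambda>y. f (y i)) \<longleftrightarrow> integrable (distr (product_law n p) borel (\<lambda>y. y i)) f"
    using measurable_data_component[OF i] f
    by (subst integrable_distr_eq) (auto simp: product_law_def)
  then show ?thesis
    unfolding distr_product_law[OF i] using f by (simp add: integrable_distr_eq)
qed

lemma integral_product_law_component:
  fixes f :: "real \<Rightarrow> real"
  assumes i: "i \<in> {1..n}" and f: "f \<in> borel_measurable borel"
  shows "(\<integral>y. f (y i) \<partial>product_law n p) = measure_pmf.expectation (p i) f"
proof -
  have "(\<integral>y. f (y i) \<partial>product_law n p) = (\<integral>x. f x \<partial>distr (product_law n p) borel (\<lambda>y. y i))"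
    using measurable_data_component[OF i] f
    by (subst integral_distr) (auto simp: product_law_def)
  then show ?thesis
    unfolding distr_product_law[OF i] using f by (simp add: integral_distr)
qed

lemma indep_vars_product_law:
  assumes "n \<ge> 1"
  shows "prob_space.indep_vars (product_law n p) (\<lambda>_. borel) (\<lambda>i y. y i - c i) {1..n}"
proof -
  have "prob_space.indep_vars (measure_pmf (Pi_pmf {1..n} undefined p)) (\<lambda>_. borel)
          (\<lambda>i y. y i - c i) {1..n}"
    by (rule prob_space.indep_vars_compose2[OF measure_pmf.prob_space_axioms indep_vars_Pi_pmf]) auto
  then have "prob_space.indep_vars (measure_pmf (Pi_pmf {1..n} undefined p)) (\<lambda>_. borel)
          (\<lambda>i y. restrict y {1..n} i - c i) {1..n}"
    by (subst prob_space.indep_vars_cong[OF measure_pmf.prob_space_axioms]) auto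
  then show ?thesis
    unfolding product_law_def
    using assms
    by (intro indep_vars_distr measure_pmf.prob_space_axioms restrict_measurable_pmf
          borel_measurable_diff measurable_data_component) auto
qed

section \<open>The locations admitted by the class\<close>

text \<open>The restrictions which membership in the class puts on the location of the change point
  alone. The last one says that the order \<open>r\<close> is active for a jump of size \<open>\<kappa>\<close>.\<close>

definition feasible ::
  "nat \<Rightarrow> nat \<Rightarrow> real \<Rightarrow> real \<Rightarrow> real \<Rightarrow> real \<Rightarrow> real \<Rightarrow> nat \<Rightarrow> bool" where
  "feasible n r cn cs \<kappa> \<sigma> z \<eta> \<longleftrightarrow>
     1 < \<eta> \<and> \<eta> \<le> n \<and> real (spacing n \<eta>) < real n / 2 \<and>
     \<sigma>\<^sup>2 * real n ^ (2 * r) * z \<le> \<kappa>\<^sup>2 * real (spacing n \<eta>) ^ (2 * r + 1) \<and>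
     cs * (cn * \<sigma>\<^sup>2 * ln (real n)) \<le> \<kappa>\<^sup>2 * real (spacing n \<eta>) ^ (2 * r + 1) / real n ^ (2 * r)"

lemma feasible_if_model_class:
  assumes "(P, \<eta>) \<in> model_class n r cn cs \<kappa> \<sigma> z"
  shows "feasible n r cn cs \<kappa> \<sigma> z \<eta>"
proof -
  from assms obtain a b where ab:
    "one_change_model n r \<sigma> P \<eta> a b" "active_orders n r cn cs \<sigma> \<eta> a b \<noteq> {}"
    "change_order n r cn cs \<sigma> \<eta> a b = r" "jump a b r = \<kappa>"
    "real (spacing n \<eta>) < real n / 2"
    "\<kappa>\<^sup>2 * real (spacing n \<eta>) ^ (2 * r + 1) \<ge> \<sigma>\<^sup>2 * real n ^ (2 * r) * z"
    by (auto simp: model_class_def)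
  define A where "A = active_orders n r cn cs \<sigma> \<eta> a b"
  define f where "f = order_rate n \<sigma> \<eta> a b"
  let ?M = "{l. is_arg_min f (\<lambda>l. l \<in> A) l}"
  have "finite A" by (simp add: A_def active_orders_def)
  then obtain l where "is_arg_min f (\<lambda>l. l \<in> A) l"
    using ex_is_arg_min_if_finite[of A f] ab(2) by (auto simp: A_def)
  moreover have "finite ?M"
    by (rule finite_subset[OF _ \<open>finite A\<close>]) (auto simp: is_arg_min_def)
  ultimately have "Min ?M \<in> ?M" by (intro Min_in) auto
  then have "r \<in> A"
    using ab(3) by (auto simp: change_order_def is_arg_min_def A_def f_def)
  then show ?thesis
    using ab by (auto simp: feasible_def A_def active_orders_def signal_def one_change_model_def)
qed

text \<open>The spacing is at least the smaller of the spacings of the two end points, and the lower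
  bounds in \<^const>\<open>feasible\<close> are monotone in the spacing. The upper bound \<open>spacing < n / 2\<close> fails
  only at the exact centre.\<close>

lemma feasible_between:
  assumes "feasible n r cn cs \<kappa> \<sigma> z \<eta>1" "feasible n r cn cs \<kappa> \<sigma> z \<eta>2"
    and "\<eta>1 \<le> \<eta>" "\<eta> \<le> \<eta>2" "2 * (\<eta> - 1) \<noteq> n"
  shows "feasible n r cn cs \<kappa> \<sigma> z \<eta>"
proof -
  have "spacing n \<eta>1 \<le> spacing n \<eta> \<or> spacing n \<eta>2 \<le> spacing n \<eta>"
    using assms(3,4) unfolding spacing_def by linarith
  then obtain \<theta> where \<theta>: "feasible n r cn cs \<kappa> \<sigma> z \<theta>" "spacing n \<theta> \<le> spacing n \<eta>"
    using assms(1,2) by blast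
  have "real (spacing n \<theta>) ^ (2 * r + 1) \<le> real (spacing n \<eta>) ^ (2 * r + 1)"
    using \<theta>(2) by (intro power_mono) auto
  then have mono: "\<kappa>\<^sup>2 * real (spacing n \<theta>) ^ (2 * r + 1) \<le> \<kappa>\<^sup>2 * real (spacing n \<eta>) ^ (2 * r + 1)"
    by (intro mult_left_mono) auto
  then have "\<kappa>\<^sup>2 * real (spacing n \<theta>) ^ (2 * r + 1) / real n ^ (2 * r)
      \<le> \<kappa>\<^sup>2 * real (spacing n \<eta>) ^ (2 * r + 1) / real n ^ (2 * r)"
    by (intro divide_right_mono) auto
  moreover have "real (spacing n \<eta>) < real n / 2"
  proof -
    have "\<eta>2 \<le> n" using assms(2) by (simp add: feasible_def)
    then have "2 * spacing n \<eta> < n"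
      using assms(4,5) unfolding spacing_def by linarith
    then show ?thesis by linarith
  qed
  ultimately show ?thesis
    using mono \<theta>(1) assms by (auto simp: feasible_def)
qed

text \<open>If the point at distance \<open>\<delta>\<close> is the centre, it is not the right end point, and the next
  point serves instead.\<close>

lemma feasible_pair:
  assumes "feasible n r cn cs \<kappa> \<sigma> z \<eta>1" "feasible n r cn cs \<kappa> \<sigma> z \<eta>2"
    and "\<eta>1 + \<delta> \<le> \<eta>2"
  obtains w where "feasible n r cn cs \<kappa> \<sigma> z w" "\<eta>1 + \<delta> \<le> w" "w \<le> \<eta>1 + \<delta> + 1"
proof (cases "2 * (\<eta>1 + \<delta> - 1) = n")
  case False
  then show ?thesis
    using that feasible_between[OF assms(1,2), of "\<eta>1 + \<delta>"] assms(3) by auto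
next
  case True
  have "\<eta>1 + \<delta> \<noteq> \<eta>2"
  proof
    assume "\<eta>1 + \<delta> = \<eta>2"
    moreover have "2 * spacing n \<eta>2 < n" using assms(2) unfolding feasible_def by linarith
    ultimately show False using True unfolding spacing_def by linarith
  qed
  then have "feasible n r cn cs \<kappa> \<sigma> z (\<eta>1 + \<delta> + 1)"
    using True assms(1,3) by (intro feasible_between[OF assms(1,2)]) (auto simp: feasible_def)
  then show ?thesis using that by auto
qed

section \<open>The order of the change point\<close>

text \<open>The jumps in question are those of \<open>\<kappa> (x - u / n) ^ r\<close> expanded about a point that lies
  \<open>d / n\<close> to the right of \<open>u / n\<close>. With \<open>D\<close> the spacing and \<open>X\<close> the rate of order \<open>r\<close>, the hypothesis on \<open>d\<close>
  says \<open>2 ^ r d < D X\<close>. Hence the signal of a lower order \<open>l\<close> falls short of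
  \<open>\<sigma>\<^sup>2 ln n / X ^ (2 l + 1)\<close>, which means that its rate exceeds \<open>X\<close>.\<close>

lemma change_order_eq_top:
  assumes "\<kappa> > 0" "\<sigma> > 0" "cn > 0" "cs > 0" "n \<ge> 2"
    and feas: "feasible n r cn cs \<kappa> \<sigma> z \<eta>"
    and jump: "\<And>l. l \<le> r \<Longrightarrow> jump a b l = \<kappa> * real (r choose l) * (real d / real n) ^ (r - l)"
    and d: "\<kappa>\<^sup>2 * (2 ^ r * real d) ^ (2 * r + 1) < \<sigma>\<^sup>2 * ln (real n) * real n ^ (2 * r)"
  shows "active_orders n r cn cs \<sigma> \<eta> a b \<noteq> {}" "change_order n r cn cs \<sigma> \<eta> a b = r"
proof -
  define V where "V = \<sigma>\<^sup>2 * ln (real n)"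
  define D where "D = real (spacing n \<eta>)"
  define S where "S = signal n \<eta> a b"
  define A where "A = active_orders n r cn cs \<sigma> \<eta> a b"
  define X where "X = (V / S r) powr (1 / (2 * real r + 1))"
  have "V > 0" using assms(2,5) by (simp add: V_def)
  have "D > 0" using feas by (auto simp: D_def feasible_def spacing_def)
  have S: "S l = \<kappa>\<^sup>2 / real n ^ (2 * r) * (real (r choose l) * real d ^ (r - l))\<^sup>2 * D ^ (2 * l + 1)"
    if "l \<le> r" for l
  proof -
    have "real n ^ (2 * r) = (real n ^ (r - l))\<^sup>2 * real n ^ (2 * l)"
      using that by (simp add: algebra_simps flip: power_mult power_add)
    then show ?thesis
      unfolding S_def signal_def jump[OF that] D_def[symmetric]
      by (simp add: power_mult_distrib power_divide field_simps)
  qed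
  have Sr: "S r = \<kappa>\<^sup>2 * D ^ (2 * r + 1) / real n ^ (2 * r)" by (simp add: S)
  have "S r > 0" using \<open>D > 0\<close> \<open>\<kappa> > 0\<close> \<open>n \<ge> 2\<close> by (simp add: Sr)
  have "X > 0" using \<open>V > 0\<close> \<open>S r > 0\<close> by (simp add: X_def)
  have Xpow: "X ^ (2 * r + 1) = V / S r"
  proof -
    have "X ^ (2 * r + 1) = X powr (2 * real r + 1)"
      using \<open>X > 0\<close> powr_realpow[of X "2 * r + 1"] by (simp add: add.commute)
    also have "\<dots> = V / S r"
      using \<open>V > 0\<close> \<open>S r > 0\<close> unfolding X_def by (simp add: powr_powr)
    finally show ?thesis .
  qed
  have "r \<in> A"
    using feas Sr unfolding A_def active_orders_def feasible_def S_def D_def by auto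
  then show "active_orders n r cn cs \<sigma> \<eta> a b \<noteq> {}" by (auto simp: A_def)
  have "(2 ^ r * real d) ^ (2 * r + 1) < (D * X) ^ (2 * r + 1)"
  proof -
    have "(D * X) ^ (2 * r + 1) = V * real n ^ (2 * r) / \<kappa>\<^sup>2"
      unfolding power_mult_distrib Xpow Sr using \<open>D > 0\<close> \<open>\<kappa> > 0\<close> \<open>n \<ge> 2\<close> by simp
    then show ?thesis using d \<open>\<kappa> > 0\<close> by (simp add: V_def pos_less_divide_eq mult.commute)
  qed
  then have base: "2 ^ r * real d < D * X"
    by (rule power_less_imp_less_base) (use \<open>D > 0\<close> \<open>X > 0\<close> in simp)
  have lower: "order_rate n \<sigma> \<eta> a b r < order_rate n \<sigma> \<eta> a b l" if "l \<in> A" "l \<noteq> r" for l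
  proof -
    have "l < r" using that by (auto simp: A_def active_orders_def)
    have "0 < cs * (cn * \<sigma>\<^sup>2 * ln (real n))" using assms(2-5) by simp
    also have "\<dots> \<le> S l" using that by (auto simp: A_def active_orders_def S_def)
    finally have "S l > 0" .
    have "real (r choose l) * real d ^ (r - l) < (D * X) ^ (r - l)"
    proof -
      \<comment> \<open>Since \<open>r - l \<ge> 1\<close>, the binomial coefficient can be absorbed into the base of the power.\<close>
      have "r choose l \<le> 2 ^ r" by (rule binomial_le_pow2)
      also have "(2 ^ r :: nat) \<le> (2 ^ r) ^ (r - l)" using \<open>l < r\<close> by (intro self_le_power) auto
      finally have "real (r choose l) \<le> (2 ^ r) ^ (r - l)"
        by (metis of_nat_le_iff of_nat_numeral of_nat_power)
      then have "real (r choose l) * real d ^ (r - l) \<le> (2 ^ r * real d) ^ (r - l)"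
        unfolding power_mult_distrib by (intro mult_right_mono) auto
      also have "\<dots> < (D * X) ^ (r - l)"
        using base \<open>l < r\<close> by (intro power_strict_mono) auto
      finally show ?thesis .
    qed
    then have "(real (r choose l) * real d ^ (r - l))\<^sup>2 < ((D * X) ^ (r - l))\<^sup>2"
      by (intro power_strict_mono) auto
    then have "S l * X ^ (2 * l + 1)
        < \<kappa>\<^sup>2 / real n ^ (2 * r) * ((D * X) ^ (r - l))\<^sup>2 * D ^ (2 * l + 1) * X ^ (2 * l + 1)"
      using \<open>l < r\<close> \<open>D > 0\<close> \<open>X > 0\<close> \<open>\<kappa> > 0\<close> \<open>n \<ge> 2\<close> unfolding S[OF less_imp_le[OF \<open>l < r\<close>]]
      by (intro mult_strict_right_mono mult_strict_left_mono) simp_all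
    also have "\<dots> = \<kappa>\<^sup>2 / real n ^ (2 * r) * (D * X) ^ (2 * (r - l) + (2 * l + 1))"
    proof -
      have "((D * X) ^ (r - l))\<^sup>2 = (D * X) ^ (2 * (r - l))" by (simp add: power_even_eq)
      moreover have "D ^ (2 * l + 1) * X ^ (2 * l + 1) = (D * X) ^ (2 * l + 1)"
        by (simp only: power_mult_distrib)
      ultimately show ?thesis by (simp only: power_add[of _ "2 * (r - l)"] mult.assoc)
    qed
    also have "2 * (r - l) + (2 * l + 1) = 2 * r + 1" using \<open>l < r\<close> by simp
    also have "\<kappa>\<^sup>2 / real n ^ (2 * r) * (D * X) ^ (2 * r + 1) = S r * X ^ (2 * r + 1)"
      by (simp add: Sr power_mult_distrib)
    also have "\<dots> = V" using Xpow \<open>S r > 0\<close> by simp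
    finally have "X ^ (2 * l + 1) < V / S l" using \<open>S l > 0\<close> by (simp add: field_simps)
    then have "(X ^ (2 * l + 1)) powr (1 / (2 * real l + 1)) < (V / S l) powr (1 / (2 * real l + 1))"
      using \<open>X > 0\<close> by (intro powr_less_mono2) auto
    moreover have "(X ^ (2 * l + 1)) powr (1 / (2 * real l + 1)) = X"
    proof -
      have "X ^ (2 * l + 1) = X powr (2 * real l + 1)"
        using \<open>X > 0\<close> powr_realpow[of X "2 * l + 1"] by (simp add: add.commute)
      then show ?thesis using \<open>X > 0\<close> by (simp add: powr_powr)
    qed
    ultimately show ?thesis by (simp add: order_rate_def X_def V_def S_def)
  qed
  have "{l. is_arg_min (order_rate n \<sigma> \<eta> a b) (\<lambda>l. l \<in> A) l} = {r}"
    using \<open>r \<in> A\<close> lower by (auto simp: is_arg_min_def) (metis less_asym)+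
  then show "change_order n r cn cs \<sigma> \<eta> a b = r" by (simp add: change_order_def A_def)
qed

section \<open>The two laws\<close>

text \<open>The base point \<open>u\<close> of the polynomial is fixed while the change point \<open>e\<close> is \<open>u\<close> or \<open>w\<close>.
  The symmetric form \<open>\<plusminus> g / 2\<close> gives coins with opposite means, and it halves the
  amplitude that the noise has to cover.\<close>

definition kinked_signal :: "nat \<Rightarrow> nat \<Rightarrow> real \<Rightarrow> nat \<Rightarrow> nat \<Rightarrow> real \<Rightarrow> real" where
  "kinked_signal n r \<kappa> u e x =
     (if x < real e / real n then - 1 else 1) * (\<kappa> / 2 * (x - real u / real n) ^ r)"

definition kinked_marginal ::
  "nat \<Rightarrow> nat \<Rightarrow> real \<Rightarrow> real \<Rightarrow> nat \<Rightarrow> nat \<Rightarrow> nat \<Rightarrow> nat \<Rightarrow> real pmf" where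
  "kinked_marginal n r \<kappa> s u w e i =
     (if i \<in> {u..<w} then coin s (kinked_signal n r \<kappa> u e (real i / real n))
      else return_pmf (kinked_signal n r \<kappa> u e (real i / real n)))"

text \<open>The coefficients are those of the binomial expansion of \<open>\<plusminus> g / 2\<close> about \<open>e / n\<close>. Their jump of
  order \<open>l\<close> is \<open>\<kappa> (r choose l) ((e - u) / n) ^ (r - l)\<close>, which is \<open>\<kappa>\<close> for \<open>l = r\<close>.\<close>

lemma kinked_law_in_model_class:
  assumes pos: "\<kappa> > 0" "\<sigma> > 0" "cn > 0" "cs > 0" "n \<ge> 2" "s > 0" and s: "\<sigma>\<^sup>2 = 2 * s\<^sup>2"
    and feas: "feasible n r cn cs \<kappa> \<sigma> z e"
    and window: "\<And>i. i \<in> {u..<w} \<Longrightarrow> \<kappa> / 2 * ((real i - real u) / real n) ^ r \<le> s"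
    and "u \<le> e"
    and d: "\<kappa>\<^sup>2 * (2 ^ r * real (e - u)) ^ (2 * r + 1) < \<sigma>\<^sup>2 * ln (real n) * real n ^ (2 * r)"
  shows "(product_law n (kinked_marginal n r \<kappa> s u w e), e) \<in> model_class n r cn cs \<kappa> \<sigma> z"
proof -
  define b where "b l = \<kappa> / 2 * real (r choose l) * (real (e - u) / real n) ^ (r - l)" for l
  define a where "a l = - b l" for l
  define f where "f = kinked_signal n r \<kappa> u e"
  define p where "p = kinked_marginal n r \<kappa> s u w e"
  let ?P = "product_law n p"
  have jump: "jump a b l = \<kappa> * real (r choose l) * (real (e - u) / real n) ^ (r - l)" for l
  proof -
    have "b l \<ge> 0" using pos by (simp add: b_def)
    then have "jump a b l = 2 * b l" by (simp add: jump_def a_def)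
    then show ?thesis by (simp add: b_def)
  qed
  note order = change_order_eq_top[OF pos(1-5) feas jump d]
  have expand: "(\<Sum>l = 0..r. b l * (x - real e / real n) ^ l) = \<kappa> / 2 * (x - real u / real n) ^ r" for x
  proof -
    have "x - real u / real n = (x - real e / real n) + real (e - u) / real n"
      using \<open>u \<le> e\<close> by (simp add: of_nat_diff diff_divide_distrib)
    then have "\<kappa> / 2 * (x - real u / real n) ^ r
        = \<kappa> / 2 * (\<Sum>l\<le>r. real (r choose l) * (x - real e / real n) ^ l * (real (e - u) / real n) ^ (r - l))"
      by (simp only: binomial_ring)
    then show ?thesis
      by (simp add: b_def sum_distrib_left atLeast0AtMost mult_ac)
  qed
  have left: "f x = (\<Sum>l = 0..r. a l * (x - real e / real n) ^ l)" if "x < real e / real n" for x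
    using that expand[of x] by (simp add: a_def f_def kinked_signal_def sum_negf)
  have right: "f x = (\<Sum>l = 0..r. b l * (x - real e / real n) ^ l)" if "real e / real n \<le> x" for x
    using that expand[of x] by (simp add: f_def kinked_signal_def)
  have small: "\<bar>f (real i / real n)\<bar> \<le> s" if "i \<in> {u..<w}" for i
  proof -
    have "0 \<le> \<kappa> / 2 * ((real i - real u) / real n) ^ r" using that pos by simp
    then show ?thesis using window[OF that] by (auto simp: f_def kinked_signal_def diff_divide_distrib)
  qed
  have finite_support: "finite (set_pmf (p i))" for i
    by (simp add: p_def kinked_marginal_def coin_def)
  have noise: "integrable ?P (\<lambda>y. y i - f (real i / real n))"
    "(\<integral>y. y i - f (real i / real n) \<partial>?P) = 0"
    "psi2_norm ?P (\<lambda>y. y i - f (real i / real n)) \<le> ennreal \<sigma>" if i: "i \<in> {1..n}" for i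
  proof -
    define c where "c = f (real i / real n)"
    have int: "integrable (p i) g" for g :: "real \<Rightarrow> real"
      by (rule integrable_measure_pmf_finite[OF finite_support])
    have meas: "(\<lambda>x. x - c) \<in> borel_measurable borel"
      "(\<lambda>x. ennreal (exp ((x - c)\<^sup>2 / \<sigma>\<^sup>2))) \<in> borel_measurable borel"
      by measurable
    show "integrable ?P (\<lambda>y. y i - f (real i / real n))"
      using iffD2[OF integrable_product_law_component[OF i meas(1), where p = p] int[of "\<lambda>x. x - c"]] unfolding c_def .
    have "(\<integral>y. y i - c \<partial>?P) = measure_pmf.expectation (p i) (\<lambda>x. x - c)"
      by (rule integral_product_law_component[OF i meas(1)])
    also have "\<dots> = measure_pmf.expectation (p i) (\<lambda>x. x) - c"
      using int by (simp add: Bochner_Integration.integral_diff)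
    also have "measure_pmf.expectation (p i) (\<lambda>x. x) = c"
      using small[of i] \<open>s > 0\<close> by (simp add: p_def kinked_marginal_def f_def c_def expectation_coin)
    finally show "(\<integral>y. y i - f (real i / real n) \<partial>?P) = 0" by (simp add: c_def)
    have "(\<integral>\<^sup>+ y. ennreal (exp ((y i - c)\<^sup>2 / \<sigma>\<^sup>2)) \<partial>?P) = (\<integral>\<^sup>+ x. ennreal (exp ((x - c)\<^sup>2 / \<sigma>\<^sup>2)) \<partial>p i)"
      by (rule nn_integral_product_law_component[OF i meas(2)])
    also have "\<dots> \<le> 2"
      using coin_sub_gaussian[OF \<open>s > 0\<close> s] small[of i]
      by (simp add: p_def kinked_marginal_def f_def c_def)
    finally show "psi2_norm ?P (\<lambda>y. y i - f (real i / real n)) \<le> ennreal \<sigma>"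
      unfolding psi2_norm_def c_def using \<open>\<sigma> > 0\<close> by (intro Inf_lower) auto
  qed
  have "0 < signal n e a b r"
    using feas pos jump[of r] by (simp add: signal_def feasible_def spacing_def)
  also have "\<dots> \<le> (MAX l \<in> {0..r}. signal n e a b l)" by (intro Max_ge) auto
  finally have "(MAX l \<in> {0..r}. signal n e a b l) > 0" .
  moreover have "1 < e" "e \<le> n" using feas by (auto simp: feasible_def)
  ultimately have "one_change_model n r \<sigma> ?P e a b"
    unfolding one_change_model_def
    using noise left right indep_vars_product_law[of n p "\<lambda>i. f (real i / real n)"] pos
      prob_space_product_law sets_product_law
    by (auto intro!: exI[of _ f])
  then show ?thesis
    using order feas jump[of r] unfolding model_class_def p_def feasible_def by auto
qed

text \<open>Bernoulli's inequality bounds \<open>k\<close> of the factors together by \<open>1 / 2\<close>; the one that may be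
  left over is at least \<open>1 / 2\<close> by itself.\<close>

lemma prod_one_minus_ge:
  fixes x :: "'a \<Rightarrow> real"
  assumes "card W \<le> k + 1" "k \<ge> 1"
    and x: "\<And>i. i \<in> W \<Longrightarrow> 0 \<le> x i \<and> x i \<le> 1 / (2 * real k)"
  shows "1 / 4 \<le> (\<Prod>i\<in>W. 1 - x i)"
proof -
  define t where "t = 1 / (2 * real k)"
  have t: "0 \<le> t" "t \<le> 1 / 2" "real k * t = 1 / 2" using \<open>k \<ge> 1\<close> by (auto simp: t_def field_simps)
  have "1 / 2 \<le> (1 - t) ^ k"
    using Bernoulli_inequality[of "- t" k] t by simp
  then have "(1 / 2) * (1 / 2) \<le> (1 - t) ^ k * (1 - t)"
    using t by (intro mult_mono) auto
  also have "\<dots> = (1 - t) ^ (k + 1)" by simp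
  also have "\<dots> \<le> (1 - t) ^ card W" using t assms by (intro power_decreasing) auto
  also have "\<dots> = (\<Prod>i\<in>W. 1 - t)" by simp
  also have "\<dots> \<le> (\<Prod>i\<in>W. 1 - x i)"
    using x t by (intro prod_mono) (auto simp: t_def)
  finally show ?thesis by simp
qed

text \<open>On the window the two marginals are coins with means \<open>\<plusminus> x\<^sub>i s\<close>, so their probabilities
  \<open>(1 \<plusminus> x\<^sub>i) / 2\<close> of a value are exchanged between the two laws and multiply to
  \<open>(1 - x\<^sub>i\<^sup>2) / 4\<close>. Outside the window the two marginals coincide.\<close>

lemma kinked_overlap:
  fixes n r u w k :: nat
  assumes "s > 0" "n \<ge> 1" "w \<le> u + k + 1" "k \<ge> 1" "u \<le> w" "w \<le> n" "1 \<le> u"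
    and close: "\<And>i. i \<in> {u..<w} \<Longrightarrow> (\<kappa> / 2 * ((real i - real u) / real n) ^ r / s)\<^sup>2 \<le> 1 / (2 * real k)"
  defines "q \<equiv> \<lambda>i. if i \<in> {u..<w} then coin s 0 else kinked_marginal n r \<kappa> s u w u i"
  shows "1 / 4 * (pmf (Pi_pmf {1..n} undefined q) y)\<^sup>2
    \<le> pmf (Pi_pmf {1..n} undefined (kinked_marginal n r \<kappa> s u w u)) y
       * pmf (Pi_pmf {1..n} undefined (kinked_marginal n r \<kappa> s u w w)) y"
proof -
  define x where "x i = \<kappa> / 2 * ((real i - real u) / real n) ^ r / s" for i
  define K where "K i = (if i \<in> {u..<w} then 1 - (x i)\<^sup>2 else 1)" for i
  let ?p = "kinked_marginal n r \<kappa> s u w"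
  have K: "1 / 4 \<le> (\<Prod>i=1..n. K i)"
  proof -
    have "1 / 4 \<le> (\<Prod>i\<in>{u..<w}. 1 - (x i)\<^sup>2)"
      using assms by (intro prod_one_minus_ge[of _ k]) (auto simp: x_def)
    also have "\<dots> = (\<Prod>i=1..n. K i)"
      using assms by (intro prod.mono_neutral_cong_left) (auto simp: K_def)
    finally show ?thesis .
  qed
  have pair: "pmf (?p u i) v * pmf (?p w i) v = K i * (pmf (q i) v)\<^sup>2" for i v
  proof (cases "i \<in> {u..<w}")
    case True
    have means: "kinked_signal n r \<kappa> u u (real i / real n) = x i * s"
      "kinked_signal n r \<kappa> u w (real i / real n) = - (x i * s)"
      using True \<open>s > 0\<close> \<open>n \<ge> 1\<close>
      by (simp_all add: kinked_signal_def x_def divide_less_cancel diff_divide_distrib)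
    have "1 / (2 * real k) \<le> 1" using \<open>k \<ge> 1\<close> by simp
    with close[OF True] have "(x i)\<^sup>2 \<le> 1" unfolding x_def by (rule order_trans)
    then have "\<bar>x i\<bar> \<le> 1" by (simp add: abs_square_le_1)
    then have bound: "\<bar>x i * s\<bar> \<le> s" "\<bar>- (x i * s)\<bar> \<le> s"
      using \<open>s > 0\<close> by (simp_all add: abs_mult)
    show ?thesis
      using True \<open>s > 0\<close> unfolding kinked_marginal_def q_def K_def means
      by (simp add: pmf_coin bound power2_eq_square) (simp add: algebra_simps)
  next
    case False
    have "kinked_signal n r \<kappa> u u (real i / real n) = kinked_signal n r \<kappa> u w (real i / real n)"
      using False assms by (auto simp: kinked_signal_def divide_less_cancel)
    then show ?thesis
      using False unfolding kinked_marginal_def q_def K_def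
      by (auto simp: indicator_def)
  qed
  show ?thesis
  proof (cases "\<forall>i. i \<notin> {1..n} \<longrightarrow> y i = undefined")
    case True
    have "pmf (Pi_pmf {1..n} undefined (?p u)) y * pmf (Pi_pmf {1..n} undefined (?p w)) y
        = (\<Prod>i=1..n. K i * (pmf (q i) (y i))\<^sup>2)"
      using True by (simp add: pmf_Pi pair flip: prod.distrib)
    also have "\<dots> = (\<Prod>i=1..n. K i) * (pmf (Pi_pmf {1..n} undefined q) y)\<^sup>2"
      using True by (simp add: pmf_Pi prod.distrib prod_power_distrib)
    finally show ?thesis using mult_right_mono[OF K zero_le_power2] by (simp only:)
  next
    case False
    then have "pmf (Pi_pmf {1..n} undefined q) y = 0"
      by (intro pmf_Pi_outside) auto
    then show ?thesis by simp
  qed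
qed

section \<open>The minimax bound\<close>

text \<open>The window starts at the left one of the two given locations and has \<open>k\<close> or \<open>k + 1\<close> points,
  where \<open>k\<close> is the integer part of \<open>m\<close>. The sum of the two risks is at least
  \<open>k K / 2\<close> with \<open>K = 1 / 4\<close>, hence at least \<open>m / 16\<close> because \<open>k \<ge> m / 2\<close>, and one of the two risks
  is at least half of the sum.\<close>

lemma minimax_risk_ge:
  assumes pos: "\<kappa> > 0" "\<sigma> > 0" "cn > 0" "cs > 0"
    and large: "2 ^ ((r + 1) * (2 * r + 1)) < ln (real n)"
    and m_def: "m = (real n ^ (2 * r) * \<sigma>\<^sup>2 / \<kappa>\<^sup>2) powr (1 / (2 * real r + 1))"
    and "\<kappa> \<le> real n ^ r * \<sigma>"
    and feas: "feasible n r cn cs \<kappa> \<sigma> z \<eta>1" "feasible n r cn cs \<kappa> \<sigma> z \<eta>2"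
    and far: "m \<le> \<bar>real \<eta>1 - real \<eta>2\<bar>"
  shows "ennreal (m / 32) \<le> minimax_risk n (model_class n r cn cs \<kappa> \<sigma> z)"
proof -
  define M where "M = real n ^ (2 * r) * \<sigma>\<^sup>2 / \<kappa>\<^sup>2"
  have "n \<ge> 2"
  proof (rule ccontr)
    assume "\<not> n \<ge> 2"
    then have "n = 0 \<or> n = 1" by auto
    moreover have "(0::real) < 2 ^ ((r + 1) * (2 * r + 1))" by simp
    ultimately show False using large by auto
  qed
  have "M \<ge> 1"
  proof -
    have "\<kappa>\<^sup>2 \<le> (real n ^ r * \<sigma>)\<^sup>2" using \<open>\<kappa> \<le> real n ^ r * \<sigma>\<close> pos by (intro power_mono) auto
    then show ?thesis using pos by (simp add: M_def power_mult_distrib power_even_eq)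
  qed
  have "m \<ge> 1" using \<open>M \<ge> 1\<close> by (simp add: m_def M_def[symmetric] ge_one_powr_ge_zero)
  have m_pow: "m ^ (2 * r + 1) = M"
  proof -
    have "m ^ (2 * r + 1) = m powr (2 * real r + 1)"
      using \<open>m \<ge> 1\<close> powr_realpow[of m "2 * r + 1"] by (simp add: add.commute)
    then show ?thesis
      using \<open>M \<ge> 1\<close> by (simp add: m_def M_def[symmetric] powr_powr)
  qed
  define k where "k = nat \<lfloor>m\<rfloor>"
  have k: "k \<ge> 1" "real k \<le> m" using \<open>m \<ge> 1\<close> unfolding k_def by linarith+
  have "m < real k + 1" using \<open>m \<ge> 1\<close> unfolding k_def by linarith
  with k have k2: "m \<le> 2 * real k" by linarith
  obtain u v where uv: "feasible n r cn cs \<kappa> \<sigma> z u" "feasible n r cn cs \<kappa> \<sigma> z v" "u + k \<le> v"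
  proof (cases "\<eta>1 \<le> \<eta>2")
    case True
    then have "\<eta>1 + k \<le> \<eta>2" using far k by linarith
    then show ?thesis using feas that by blast
  next
    case False
    then have "\<eta>2 + k \<le> \<eta>1" using far k by linarith
    then show ?thesis using feas that by blast
  qed
  obtain w where w: "feasible n r cn cs \<kappa> \<sigma> z w" "u + k \<le> w" "w \<le> u + k + 1"
    by (rule feasible_pair[OF uv])
  have bounds: "1 \<le> u" "w \<le> n" "u \<le> w" using uv w by (auto simp: feasible_def)
  define s where "s = \<sigma> / sqrt 2"
  have s: "s > 0" "\<sigma>\<^sup>2 = 2 * s\<^sup>2" using pos by (auto simp: s_def power_divide)
  \<comment> \<open>The squared bias of the coins, \<open>j ^ (2 r) / (2 m ^ (2 r + 1))\<close> with
      \<open>j \<le> k \<le> m\<close>. Even in a window of \<open>k + 1\<close> points the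
      distance \<open>j\<close> to \<open>u\<close> is at most \<open>k\<close>.\<close>
  have close: "(\<kappa> / 2 * ((real i - real u) / real n) ^ r / s)\<^sup>2 \<le> 1 / (2 * real k)"
    if i: "i \<in> {u..<w}" for i
  proof -
    define j where "j = real i - real u"
    have j: "0 \<le> j" "j \<le> real k" using i w by (auto simp: j_def)
    have "real k ^ (2 * r + 1) \<le> M"
      unfolding m_pow[symmetric] using k by (intro power_mono) auto
    have "(\<kappa> / 2 * (j / real n) ^ r / s)\<^sup>2 = j ^ (2 * r) / (2 * M)"
      using pos s by (simp add: M_def power_divide power_mult_distrib power_even_eq) (simp only: mult_ac)
    also have "\<dots> \<le> real k ^ (2 * r) / (2 * real k ^ (2 * r + 1))"
      using j k \<open>real k ^ (2 * r + 1) \<le> M\<close> by (intro frac_le mult_left_mono power_mono) auto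
    also have "\<dots> = 1 / (2 * real k)" using k by simp
    finally show ?thesis by (simp add: j_def)
  qed
  have window: "\<kappa> / 2 * ((real i - real u) / real n) ^ r \<le> s" if i: "i \<in> {u..<w}" for i
  proof -
    have "1 / (2 * real k) \<le> 1" using k by simp
    with close[OF i] have "(\<kappa> / 2 * ((real i - real u) / real n) ^ r / s)\<^sup>2 \<le> 1"
      by (rule order_trans)
    then have "\<kappa> / 2 * ((real i - real u) / real n) ^ r / s \<le> 1"
      unfolding abs_square_le_1 by (rule order_trans[OF abs_ge_self])
    then show ?thesis using s by simp
  qed
  have drift: "\<kappa>\<^sup>2 * (2 ^ r * real (w - u)) ^ (2 * r + 1) < \<sigma>\<^sup>2 * ln (real n) * real n ^ (2 * r)"
  proof -
    have "real (w - u) \<le> 2 * m" using w k k2 by linarith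
    then have "(2 ^ r * real (w - u)) ^ (2 * r + 1) \<le> (2 ^ (r + 1) * m) ^ (2 * r + 1)"
      by (intro power_mono) auto
    also have "\<dots> = 2 ^ ((r + 1) * (2 * r + 1)) * M"
      unfolding power_mult_distrib m_pow by (simp only: power_mult)
    also have "\<dots> < ln (real n) * M" using large \<open>M \<ge> 1\<close> by (intro mult_strict_right_mono) auto
    finally have "\<kappa>\<^sup>2 * (2 ^ r * real (w - u)) ^ (2 * r + 1) < \<kappa>\<^sup>2 * (ln (real n) * M)"
      using pos by (intro mult_strict_left_mono) auto
    then show ?thesis using pos by (simp add: M_def mult_ac)
  qed
  have no_drift: "\<kappa>\<^sup>2 * (2 ^ r * real (u - u)) ^ (2 * r + 1) < \<sigma>\<^sup>2 * ln (real n) * real n ^ (2 * r)"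
    using pos \<open>n \<ge> 2\<close> by simp
  define p where "p = kinked_marginal n r \<kappa> s u w"
  have in_class: "(product_law n (p e), e) \<in> model_class n r cn cs \<kappa> \<sigma> z"
    if "feasible n r cn cs \<kappa> \<sigma> z e" "u \<le> e"
      "\<kappa>\<^sup>2 * (2 ^ r * real (e - u)) ^ (2 * r + 1) < \<sigma>\<^sup>2 * ln (real n) * real n ^ (2 * r)" for e
    unfolding p_def
    by (rule kinked_law_in_model_class[OF pos \<open>n \<ge> 2\<close> s that(1) _ that(2,3)]) (rule window)
  have members: "(product_law n (p u), u) \<in> model_class n r cn cs \<kappa> \<sigma> z"
    "(product_law n (p w), w) \<in> model_class n r cn cs \<kappa> \<sigma> z"
    by (rule in_class[OF uv(1) order_refl no_drift], rule in_class[OF w(1) bounds(3) drift])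
  show ?thesis
    unfolding minimax_risk_def
  proof (rule INF_greatest)
    fix est :: "(nat \<Rightarrow> real) \<Rightarrow> real" assume est: "est \<in> borel_measurable (data_space n)"
    define risk where "risk = (\<lambda>(P, \<eta>). \<integral>\<^sup>+ y. ennreal \<bar>est y - real \<eta>\<bar> \<partial>P)"
    define S where "S = (SUP Q \<in> model_class n r cn cs \<kappa> \<sigma> z. risk Q)"
    have risk_eq: "risk (product_law n (p e), e)
        = (\<integral>\<^sup>+ y. ennreal \<bar>est (restrict y {1..n}) - real e\<bar> \<partial>Pi_pmf {1..n} undefined (p e))" for e
      unfolding risk_def using est by (simp add: nn_integral_product_law)
    have "ennreal (\<bar>real u - real w\<bar> * (1 / 4) / 2) \<le> risk (product_law n (p u), u) + risk (product_law n (p w), w)"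
      unfolding risk_eq unfolding p_def
      by (rule two_point_risk, simp, rule kinked_overlap[OF s(1) _ w(3) k(1) bounds(3,2,1)])
        (use \<open>n \<ge> 2\<close> close in simp_all)
    also have "\<dots> \<le> S + S"
      unfolding S_def using members by (intro add_mono SUP_upper)
    finally have "ennreal (\<bar>real u - real w\<bar> * (1 / 4) / 2) \<le> S + S" .
    moreover have "real k \<le> \<bar>real u - real w\<bar>" using w(2) by linarith
    then have "m / 16 \<le> \<bar>real u - real w\<bar> * (1 / 4) / 2" using k2 by simp
    ultimately have "ennreal (m / 16) \<le> S + S" by (meson ennreal_leI order_trans)
    then have "ennreal (m / 32) \<le> S"
      by (cases S) (auto simp flip: ennreal_plus)
    then show "ennreal (m / 32) \<le> (SUP (P, \<eta>) \<in> model_class n r cn cs \<kappa> \<sigma> z. \<integral>\<^sup>+ y. ennreal \<bar>est y - real \<eta>\<bar> \<partial>P)"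
      by (simp add: S_def risk_def)
  qed
qed

text \<open>The constant will be \<open>c = (1 / 32) ^ (2 r + 1)\<close>, since \<open>c\<close> stands under the \<open>(2 r + 1)\<close>-st root.\<close>

theorem lemma2:
  fixes r :: nat
  shows "\<exists>c::real. 0 < c \<and> c < 1 \<and>
    (\<forall>(cn::real) (cs::real) (\<zeta>::nat \<Rightarrow> real) (\<kappa>::nat \<Rightarrow> real) (\<sigma>::nat \<Rightarrow> real).
       cn > 0 \<longrightarrow> cs > 0 \<longrightarrow> filterlim \<zeta> at_top sequentially \<longrightarrow>
       (\<forall>n. \<kappa> n > 0) \<longrightarrow> (\<forall>n. \<sigma> n > 0) \<longrightarrow>
       (\<forall>\<^sub>F n in sequentially.
          \<kappa> n \<le> real n ^ r * \<sigma> n \<longrightarrow>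
          (\<exists>(P, \<eta>) \<in> model_class n r cn cs (\<kappa> n) (\<sigma> n) (\<zeta> n).
           \<exists>(P', \<eta>') \<in> model_class n r cn cs (\<kappa> n) (\<sigma> n) (\<zeta> n).
             (real n ^ (2 * r) * (\<sigma> n)\<^sup>2 / (\<kappa> n)\<^sup>2) powr (1 / (2 * real r + 1))
               \<le> \<bar>real \<eta> - real \<eta>'\<bar>) \<longrightarrow>
          minimax_risk n (model_class n r cn cs (\<kappa> n) (\<sigma> n) (\<zeta> n))
            \<ge> ennreal ((c * real n ^ (2 * r) * (\<sigma> n)\<^sup>2 / (\<kappa> n)\<^sup>2) powr (1 / (2 * real r + 1)))))"
proof (intro exI[of _ "(1 / 32) ^ (2 * r + 1)"] conjI allI impI)
  show "(0::real) < (1 / 32) ^ (2 * r + 1)" by simp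
  show "(1 / 32) ^ (2 * r + 1) < (1::real)" by (rule power_Suc_less_one[of _ "2 * r", simplified Suc_eq_plus1]) auto
next
  fix cn cs :: real and \<zeta> \<kappa> \<sigma> :: "nat \<Rightarrow> real"
  assume pos: "cn > 0" "cs > 0" "\<forall>n. \<kappa> n > 0" "\<forall>n. \<sigma> n > 0"
  have "filterlim (\<lambda>n. ln (real n)) at_top sequentially"
    by (intro filterlim_compose[OF ln_at_top] filterlim_real_sequentially)
  then have large: "\<forall>\<^sub>F n in sequentially. 2 ^ ((r + 1) * (2 * r + 1)) < ln (real n)"
    by (simp add: filterlim_at_top_dense)
  show "\<forall>\<^sub>F n in sequentially.
          \<kappa> n \<le> real n ^ r * \<sigma> n \<longrightarrow>
          (\<exists>(P, \<eta>) \<in> model_class n r cn cs (\<kappa> n) (\<sigma> n) (\<zeta> n).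
           \<exists>(P', \<eta>') \<in> model_class n r cn cs (\<kappa> n) (\<sigma> n) (\<zeta> n).
             (real n ^ (2 * r) * (\<sigma> n)\<^sup>2 / (\<kappa> n)\<^sup>2) powr (1 / (2 * real r + 1))
               \<le> \<bar>real \<eta> - real \<eta>'\<bar>) \<longrightarrow>
          minimax_risk n (model_class n r cn cs (\<kappa> n) (\<sigma> n) (\<zeta> n))
            \<ge> ennreal (((1 / 32) ^ (2 * r + 1) * real n ^ (2 * r) * (\<sigma> n)\<^sup>2 / (\<kappa> n)\<^sup>2) powr (1 / (2 * real r + 1)))"
    using large
  proof (rule eventually_mono, intro impI)
    fix n
    assume elim: "2 ^ ((r + 1) * (2 * r + 1)) < ln (real n)" "\<kappa> n \<le> real n ^ r * \<sigma> n"
      "\<exists>(P, \<eta>) \<in> model_class n r cn cs (\<kappa> n) (\<sigma> n) (\<zeta> n).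
           \<exists>(P', \<eta>') \<in> model_class n r cn cs (\<kappa> n) (\<sigma> n) (\<zeta> n).
             (real n ^ (2 * r) * (\<sigma> n)\<^sup>2 / (\<kappa> n)\<^sup>2) powr (1 / (2 * real r + 1))
               \<le> \<bar>real \<eta> - real \<eta>'\<bar>"
    let ?Q = "model_class n r cn cs (\<kappa> n) (\<sigma> n) (\<zeta> n)"
    define m where "m = (real n ^ (2 * r) * (\<sigma> n)\<^sup>2 / (\<kappa> n)\<^sup>2) powr (1 / (2 * real r + 1))"
    from elim(3) obtain P \<eta> P' \<eta>' where "(P, \<eta>) \<in> ?Q" "(P', \<eta>') \<in> ?Q" "m \<le> \<bar>real \<eta> - real \<eta>'\<bar>"
      unfolding m_def by blast
    then have "ennreal (m / 32) \<le> minimax_risk n ?Q"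
      using pos elim(1,2)
      by (intro minimax_risk_ge[OF _ _ _ _ _ m_def _ feasible_if_model_class feasible_if_model_class]) auto
    moreover have "((1 / 32) ^ (2 * r + 1) * real n ^ (2 * r) * (\<sigma> n)\<^sup>2 / (\<kappa> n)\<^sup>2) powr (1 / (2 * real r + 1)) = m / 32"
    proof -
      have "((1 / 32 :: real) ^ (2 * r + 1)) powr (1 / (2 * real r + 1)) = 1 / 32"
      proof -
        have "(1 / 32 :: real) ^ (2 * r + 1) = (1 / 32) powr (2 * real r + 1)"
          using powr_realpow[of "1 / 32 :: real" "2 * r + 1"] by (simp add: add.commute)
        then show ?thesis by (simp add: powr_powr)
      qed
      moreover have "(1 / 32) ^ (2 * r + 1) * real n ^ (2 * r) * (\<sigma> n)\<^sup>2 / (\<kappa> n)\<^sup>2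
          = (1 / 32) ^ (2 * r + 1) * (real n ^ (2 * r) * (\<sigma> n)\<^sup>2 / (\<kappa> n)\<^sup>2)" by simp
      ultimately show ?thesis by (simp only: powr_mult m_def)
    qed
    ultimately show "ennreal (((1 / 32) ^ (2 * r + 1) * real n ^ (2 * r) * (\<sigma> n)\<^sup>2 / (\<kappa> n)\<^sup>2) powr (1 / (2 * real r + 1)))
        \<le> minimax_risk n ?Q" by (simp only:)
  qed
qed

end
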